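(* Let $h_1,h_2,l_1,l_2,k_1,k_2\in\mathbb{C}$ and $t_1,t_2\in\mathbb{C}\setminus\{0\}$. Put $$\lambda=\tfrac12(h_1+h_2-l_1-l_2-k_1+k_2+1),\qquad \mu'=-k_1+k_2,\qquad \lambda=\widetilde{\lambda}+k_2,$$ $$\alpha_1=\frac{q^{-l_1+1/2}}{t_1},\quad \alpha_2=\frac{q^{-l_2+3/2}}{t_2},\quad \beta_1=\frac{q^{\lambda-h_1+1/2}}{t_1},\quad \beta_2=\frac{q^{\lambda-h_2+1/2}}{t_2}.$$ Let $$y_x(x)=(1-q)q^{\lambda-\mu'}x^{\mu'}\frac{(q^2/(\beta_1x),\,q^2/(\beta_2x),\,q;q)_\infty}{(q/(\alpha_1x),\,q^2/(\alpha_2x),\,q^{-\lambda+1};q)_\infty}\;{}_3\phi_2\left(\begin{array}{c}q^{-\lambda+1},\,q/(\alpha_1x),\,q^2/(\alpha_2x)\\ q^2/(\beta_1x),\,q^2/(\beta_2x)\end{array};q,\,q^{\lambda}\frac{\alpha_1\alpha_2}{\beta_1\beta_2}\right)$$ and let $g(x)$ be the $q$-Appell series solution $$g(x)=x^{-k_1}\sum_{n=0}^\infty\sum_{m=0}^\infty\frac{(q^{\widetilde\lambda+k_1};q)_{m+n}\,(q^{\widetilde\lambda+k_1-h_2+l_2};q)_m\,(q^{\widetilde\lambda+k_1-h_1+l_1};q)_n}{(q^{k_1-k_2+1};q)_{m+n}\,(q;q)_m\,(q;q)_n}\,(q^{l_1+1/2}t_1x^{-1})^m\,(q^{l_2+1/2}t_2x^{-1})^n$$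 of the variant of the $q$-hypergeometric equation of degree 2 with parameters $h_i,l_i,k_i,t_i$. Then $y_x(x)$ corresponds to a constant multiple of $g(x)$ under the gauge change $x^{-k_2}$: there is a constant $C$, independent of $x$, such that $$x^{-k_2}\,y_x(x)=C\,g(x).$$
   Context: $q$ is a complex number with $0<|q|<1$; a value of $\log q$ is fixed and $q^s=\exp(s\log q)$; a branch of $\log x$ is fixed and $x^s=\exp(s\log x)$. Notation: $(a;q)_n=\prod_{j=0}^{n-1}(1-q^ja)$, $(a;q)_\infty=\prod_{j=0}^\infty(1-q^ja)$, $(a_1,\dots,a_N;q)_n=\prod_i(a_i;q)_n$ (also for $n=\infty$), and $${}_3\phi_2\left(\begin{array}{c}a_1,a_2,a_3\\ b_1,b_2\end{array};q,z\right)=\sum_{n=0}^\infty\frac{(a_1,a_2,a_3;q)_n}{(q;q)_n(b_1,b_2;q)_n}z^n.$$ Parameters are generic, so that no denominator vanishes, and all series are assumed convergent: $|q^\lambda\alpha_1\alpha_2/(\beta_1\beta_2)|<1$, $|q/(\alpha_1x)|<1$, $|q^2/(\alpha_2x)|<1$. The variant of the $q$-hypergeometric equation of degree 2 is $$(x-q^{h_1+1/2}t_1)(x-q^{h_2+1/2}t_2)g(x/q)+q^{k_1+k_2}(x-q^{l_1-1/2}t_1)(x-q^{l_2-1/2}t_2)g(qx)-[(q^{k_1}+q^{k_2})x^2+Ex+p(q^{1/2}+q^{-1/2})t_1t_2]g(x)=0,$$ with $p=q^{(h_1+h_2+l_1+l_2+k_1+k_2)/2}$ and $E=-p\{(q^{-h_2}+q^{-l_2})t_1+(q^{-h_1}+q^{-l_1})t_2\}$.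 It is previously known that $g$ above solves this equation. It is also previously known that, when $\widehat y_1$ solves the second-order $q$-difference equation $$\Bigl(x-\frac{q^{\lambda+1}}{\beta_1}\Bigr)\Bigl(x-\frac{q^{\lambda+1}}{\beta_2}\Bigr)\widehat y_1(x/q)+\frac{\alpha_1\alpha_2}{\beta_1\beta_2}\Bigl(x-\frac1{\alpha_1}\Bigr)\Bigl(x-\frac q{\alpha_2}\Bigr)\widehat y_1(qx)-\Bigl[\Bigl(\frac{\alpha_1\alpha_2}{\beta_1\beta_2}+1\Bigr)x^2-\Bigl\{q\Bigl(\frac1{\beta_1}+\frac1{\beta_2}\Bigr)+q^\lambda\frac{q\alpha_1+\alpha_2}{\beta_1\beta_2}\Bigr\}x+\frac{q^{\lambda+1}(1+q)}{\beta_1\beta_2}\Bigr]\widehat y_1(x)=0$$ (which $y_x$ does), the function $x^{-k_2}\widehat y_1(x)$ solves the variant of degree 2 under the parameter correspondence in the claim; this is the meaning of "corresponds". *)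

theory Defs
  imports "HOL-Analysis.Analysis"
begin

text \<open>
  Powers with complex exponent are taken with respect to a chosen value of the logarithm
  of the base: if \<open>exp l = z\<close>, then \<open>lpow l s\<close> is the power \<open>z\<^sup>s\<close> belonging to \<open>l\<close>.
\<close>

definition lpow :: "complex \<Rightarrow> complex \<Rightarrow> complex" where
  "lpow l s = exp (s * l)"

definition log_branch :: "complex set \<Rightarrow> (complex \<Rightarrow> complex) \<Rightarrow> bool" where
  "log_branch S L \<longleftrightarrow>
     open S \<and> connected S \<and> continuous_on S L \<and> (\<forall>x\<in>S. exp (L x) = x)"

definition qpoch :: "complex \<Rightarrow> complex \<Rightarrow> nat \<Rightarrow> complex" where
  "qpoch q a n = (\<Prod>j<n. 1 - q ^ j * a)"

definition qpoch_inf :: "complex \<Rightarrow> complex \<Rightarrow> complex" where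
  "qpoch_inf q a = (\<Prod>j. 1 - q ^ j * a)"

definition qpochs :: "complex \<Rightarrow> complex list \<Rightarrow> nat \<Rightarrow> complex" where
  "qpochs q as n = (\<Prod>a\<leftarrow>as. qpoch q a n)"

definition qpochs_inf :: "complex \<Rightarrow> complex list \<Rightarrow> complex" where
  "qpochs_inf q as = (\<Prod>a\<leftarrow>as. qpoch_inf q a)"

definition phi32 ::
  "complex \<Rightarrow> complex \<Rightarrow> complex \<Rightarrow> complex \<Rightarrow> complex \<Rightarrow> complex \<Rightarrow> complex \<Rightarrow> complex" where
  "phi32 a1 a2 a3 b1 b2 q z =
     (\<Sum>n. qpochs q [a1, a2, a3] n / (qpoch q q n * qpochs q [b1, b2] n) * z ^ n)"

text \<open>In the next two definitions \<open>lq\<close> is the chosen value of \<open>log q\<close> and \<open>L\<close> the chosen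
  branch of \<open>log x\<close>.\<close>

definition y_x ::
  "complex \<Rightarrow> complex \<Rightarrow> (complex \<Rightarrow> complex) \<Rightarrow> complex \<Rightarrow> complex \<Rightarrow>
   complex \<Rightarrow> complex \<Rightarrow> complex \<Rightarrow> complex \<Rightarrow> complex \<Rightarrow> complex" where
  "y_x q lq L lam mu \<alpha>1 \<alpha>2 \<beta>1 \<beta>2 x =
     (1 - q) * lpow lq (lam - mu) * lpow (L x) mu
     * (qpochs_inf q [q\<^sup>2 / (\<beta>1 * x), q\<^sup>2 / (\<beta>2 * x), q]
        / qpochs_inf q [q / (\<alpha>1 * x), q\<^sup>2 / (\<alpha>2 * x), lpow lq (- lam + 1)])
     * phi32 (lpow lq (- lam + 1)) (q / (\<alpha>1 * x)) (q\<^sup>2 / (\<alpha>2 * x))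
         (q\<^sup>2 / (\<beta>1 * x)) (q\<^sup>2 / (\<beta>2 * x)) q
         (lpow lq lam * (\<alpha>1 * \<alpha>2 / (\<beta>1 * \<beta>2)))"

definition g_appell ::
  "complex \<Rightarrow> complex \<Rightarrow> (complex \<Rightarrow> complex) \<Rightarrow> complex \<Rightarrow> complex \<Rightarrow> complex \<Rightarrow>
   complex \<Rightarrow> complex \<Rightarrow> complex \<Rightarrow> complex \<Rightarrow> complex \<Rightarrow> complex \<Rightarrow> complex \<Rightarrow> complex" where
  "g_appell q lq L lamt h1 h2 l1 l2 k1 k2 t1 t2 x =
     lpow (L x) (- k1) *
     (\<Sum>n. \<Sum>m.
        qpoch q (lpow lq (lamt + k1)) (m + n)
        * qpoch q (lpow lq (lamt + k1 - h2 + l2)) m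
        * qpoch q (lpow lq (lamt + k1 - h1 + l1)) n
        / (qpoch q (lpow lq (k1 - k2 + 1)) (m + n) * qpoch q q m * qpoch q q n)
        * (lpow lq (l1 + 1/2) * t1 * inverse x) ^ m
        * (lpow lq (l2 + 1/2) * t2 * inverse x) ^ n)"

end

theory Submission
  imports Defs
begin

text \<open>
  The identity is Andrews' transformation of the \<open>q\<close>-Appell series \<open>\<Phi>\<^sup>(\<^sup>1\<^sup>)\<close> into a
  \<open>\<^sub>3\<phi>\<^sub>2\<close> series (\<open>q_appell_eq_phi32\<close>), read in the given parameters. Put
  \<open>a = q\<^sup>\<lambda>\<alpha>\<^sub>1\<alpha>\<^sub>2/(\<beta>\<^sub>1\<beta>\<^sub>2)\<close>, \<open>u = q/(\<alpha>\<^sub>1x)\<close> and \<open>v = q\<^sup>2/(\<alpha>\<^sub>2x)\<close>. The relation that defines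
  \<open>\<lambda>\<close> makes \<open>a\<close>, the argument of the \<open>\<^sub>3\<phi>\<^sub>2\<close> series, coincide with the first numerator
  parameter of the Appell series. With \<open>b\<close>, \<open>b'\<close> and \<open>c\<close> for the other Appell
  parameters, \<open>u\<close> and \<open>v\<close> are the Appell variables, and the parameters of the \<open>\<^sub>3\<phi>\<^sub>2\<close> series
  become \<open>c/a, u, v\<close> above and \<open>bu, b'v\<close> below. The infinite products that depend
  on \<open>x\<close> cancel against those in Andrews' formula, the powers of \<open>x\<close> combine by
  \<open>\<mu>' - k\<^sub>2 = -k\<^sub>1\<close>, and what remains is the constant
  \<open>C = (1 - q) q\<^bsup>\<lambda>-\<mu>'\<^esup> (q, c; q)\<^sub>\<infinity> / (c/a, a; q)\<^sub>\<infinity>\<close>.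

  Andrews' formula rests on the \<open>q\<close>-binomial theorem (\<open>q_binomial\<close>) alone. In the Appell series
  only the quotient \<open>(a;q)\<^bsub>m+n\<^esub>/(c;q)\<^bsub>m+n\<^esub>\<close> couples \<open>m\<close> and \<open>n\<close>. Up to a constant it is
  \<open>(q\<^bsup>m+n\<^esup>c;q)\<^sub>\<infinity>/(q\<^bsup>m+n\<^esup>a;q)\<^sub>\<infinity>\<close>, which the \<open>q\<close>-binomial theorem expands in powers of
  \<open>q\<^bsup>m+n\<^esup>\<close>. In each term of this expansion \<open>m\<close> and \<open>n\<close> are separated, so after an
  interchange of summations (\<open>suminf_triple_power\<close>) the sums over \<open>m\<close> and \<open>n\<close> are again
  \<open>q\<close>-binomial series, and the remaining sum is the \<open>\<^sub>3\<phi>\<^sub>2\<close> series.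
\<close>

section \<open>The q-Pochhammer symbol\<close>

lemma qpoch_0 [simp]: "qpoch q a 0 = 1"
  by (simp add: qpoch_def)

lemma qpoch_Suc: "qpoch q a (Suc n) = qpoch q a n * (1 - q ^ n * a)"
  by (simp add: qpoch_def)

lemma qpoch_add: "qpoch q a (n + m) = qpoch q a n * qpoch q (q ^ n * a) m"
  by (induction m) (simp_all add: qpoch_Suc power_add mult_ac)

lemma norm_power_mult_less_1:
  fixes q a :: complex
  assumes "norm q < 1" "norm a < 1"
  shows "norm (q ^ n * a) < 1"
proof -
  have "norm (q ^ n * a) \<le> 1 * norm a"
    unfolding norm_mult norm_power using assms
    by (intro mult_right_mono power_le_one) auto
  with assms show ?thesis by simp
qed

lemma one_minus_power_mult_nonzero:
  fixes q a :: complex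
  assumes "norm q < 1" "norm a < 1"
  shows "1 - q ^ n * a \<noteq> 0"
  using norm_power_mult_less_1[OF assms, of n] by auto

lemma qpoch_nonzero:
  assumes "norm q < 1" "norm a < 1"
  shows "qpoch q a n \<noteq> 0"
  using one_minus_power_mult_nonzero[OF assms] by (simp add: qpoch_def)

lemma convergent_prod_qpoch:
  fixes q a :: complex
  assumes "norm q < 1"
  shows "convergent_prod (\<lambda>j. 1 - q ^ j * a)"
proof (intro abs_convergent_prod_imp_convergent_prod summable_imp_abs_convergent_prod)
  have "summable (\<lambda>j. norm q ^ j * norm a)"
    using assms by (intro summable_mult2 summable_geometric) simp
  then show "summable (\<lambda>j. norm (1 - q ^ j * a - 1))"
    by (simp add: norm_mult norm_power)
qed

lemma qpoch_tendsto_qpoch_inf: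
  assumes "norm q < 1"
  shows "qpoch q a \<longlonglongrightarrow> qpoch_inf q a"
  unfolding qpoch_def qpoch_inf_def
  by (intro has_prod_imp_tendsto' convergent_prod_has_prod convergent_prod_qpoch assms)

lemma qpoch_inf_nonzero:
  assumes "norm q < 1" "\<And>n. qpoch q a n \<noteq> 0"
  shows "qpoch_inf q a \<noteq> 0"
  unfolding qpoch_inf_def
proof (intro prodinf_nonzero convergent_prod_qpoch assms(1))
  show "1 - q ^ i * a \<noteq> 0" for i
    using assms(2)[of "Suc i"] by (simp add: qpoch_Suc)
qed

lemma qpoch_inf_split:
  assumes "norm q < 1"
  shows "qpoch_inf q a = qpoch q a n * qpoch_inf q (q ^ n * a)"
proof (rule LIMSEQ_unique)
  show "(\<lambda>m. qpoch q a (m + n)) \<longlonglongrightarrow> qpoch_inf q a"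
    using qpoch_tendsto_qpoch_inf[OF assms] by (rule LIMSEQ_ignore_initial_segment)
  show "(\<lambda>m. qpoch q a (m + n)) \<longlonglongrightarrow> qpoch q a n * qpoch_inf q (q ^ n * a)"
    unfolding add.commute[of _ n] qpoch_add
    by (intro tendsto_mult_left qpoch_tendsto_qpoch_inf assms)
qed

text \<open>
  This turns the \<open>n\<close>-dependence of a quotient of finite symbols into a quotient of infinite
  products in \<open>q\<^sup>n\<close>, which is the shape of the right-hand side of the \<open>q\<close>-binomial theorem.
\<close>

lemma qpoch_quotient:
  assumes "norm q < 1" "norm a < 1" "\<And>k. qpoch q c k \<noteq> 0"
  shows "qpoch q a n / qpoch q c n
    = qpoch_inf q a / qpoch_inf q c * (qpoch_inf q (q ^ n * c) / qpoch_inf q (q ^ n * a))"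
proof -
  have "qpoch_inf q a \<noteq> 0" "qpoch_inf q c \<noteq> 0"
    using assms by (simp_all add: qpoch_inf_nonzero qpoch_nonzero)
  then show ?thesis
    using qpoch_inf_split[OF assms(1), of a n] qpoch_inf_split[OF assms(1), of c n]
    by (auto simp: field_simps)
qed

section \<open>The q-binomial theorem\<close>

lemma summable_norm_Bseq_mult:
  fixes w f :: "nat \<Rightarrow> complex"
  assumes "Bseq w" "summable (\<lambda>n. norm (f n))"
  shows "summable (\<lambda>n. norm (w n * f n))"
proof -
  obtain B where B: "\<And>n. norm (w n) \<le> B"
    using assms(1) by (auto simp: Bseq_def)
  show ?thesis
    by (rule summable_comparison_test'[OF summable_mult[OF assms(2), of B], of 0])
       (simp add: norm_mult mult_right_mono B)
qed

text \<open>
  Numerator and denominator of the coefficient converge, the latter to a nonzero limit, so the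
  coefficients are bounded and the series is dominated by a geometric one.
\<close>

lemma summable_norm_q_binomial:
  assumes "norm q < 1" "norm z < 1"
  shows "summable (\<lambda>n. norm (qpoch q a n / qpoch q q n * z ^ n))"
proof -
  have "(\<lambda>n. qpoch q a n / qpoch q q n) \<longlonglongrightarrow> qpoch_inf q a / qpoch_inf q q"
    using assms
    by (intro tendsto_divide qpoch_tendsto_qpoch_inf qpoch_inf_nonzero qpoch_nonzero) auto
  then have "Bseq (\<lambda>n. qpoch q a n / qpoch q q n)"
    by (intro convergent_imp_Bseq convergentI)
  then show ?thesis
    using assms by (intro summable_norm_Bseq_mult) (simp_all add: norm_power summable_geometric)
qed

text \<open>
  The coefficients satisfy \<open>c\<^bsub>n+1\<^esub> (1 - q\<^bsup>n+1\<^esup>) = c\<^sub>n (1 - a q\<^sup>n)\<close>. Multiplying by \<open>z\<^bsup>n+1\<^esup>\<close> and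
  summing gives \<open>F(z) - F(qz) = z F(z) - a z F(qz)\<close>.
\<close>

lemma q_binomial_step:
  fixes q a z :: complex and F :: "complex \<Rightarrow> complex"
  assumes "norm q < 1" "norm z < 1"
  defines "F \<equiv> \<lambda>z. \<Sum>n. qpoch q a n / qpoch q q n * z ^ n"
  shows "(1 - z) * F z = (1 - a * z) * F (q * z)"
proof -
  define c where "c n = qpoch q a n / qpoch q q n" for n
  have F: "(\<lambda>n. c n * w ^ n) sums F w" if "norm w < 1" for w
    unfolding F_def c_def
    by (intro summable_sums summable_norm_cancel[OF summable_norm_q_binomial] assms that)
  have c_Suc: "c (Suc n) * (1 - q ^ Suc n) = c n * (1 - a * q ^ n)" for n
    using one_minus_power_mult_nonzero[OF assms(1,1), of n] qpoch_nonzero[OF assms(1,1), of n]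
    by (simp add: c_def qpoch_Suc field_simps)
  have qz: "norm (q * z) < 1"
    using norm_power_mult_less_1[OF assms(1,2), of 1] by simp
  have "(\<lambda>n. c n * z ^ n - c n * (q * z) ^ n) sums (F z - F (q * z))"
    by (intro sums_diff F assms qz)
  then have "(\<lambda>n. c (Suc n) * z ^ Suc n - c (Suc n) * (q * z) ^ Suc n) sums (F z - F (q * z))"
    by (subst sums_Suc_iff) simp
  moreover have "c (Suc n) * z ^ Suc n - c (Suc n) * (q * z) ^ Suc n
      = z * (c n * z ^ n) - a * z * (c n * (q * z) ^ n)" for n
  proof -
    have "c (Suc n) * z ^ Suc n - c (Suc n) * (q * z) ^ Suc n
        = (c (Suc n) * (1 - q ^ Suc n)) * z ^ Suc n"
      by (simp only: power_mult_distrib) (simp add: algebra_simps)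
    also have "\<dots> = z * (c n * z ^ n) - a * z * (c n * (q * z) ^ n)"
      unfolding c_Suc by (simp add: power_mult_distrib algebra_simps)
    finally show ?thesis .
  qed
  moreover have "(\<lambda>n. z * (c n * z ^ n) - a * z * (c n * (q * z) ^ n))
      sums (z * F z - a * z * F (q * z))"
    by (intro sums_diff sums_mult F assms qz)
  ultimately have "F z - F (q * z) = z * F z - a * z * F (q * z)"
    by (simp add: sums_unique2)
  then show ?thesis
    by (simp add: algebra_simps)
qed

text \<open>
  Iterating the functional equation pushes the argument to \<open>q\<^sup>n z\<close>, which tends to \<open>0\<close>; the
  factors collected on the way are the partial products of the right-hand side, and the power
  series is continuous at \<open>0\<close> with value \<open>1\<close>.
\<close>

theorem q_binomial:
  assumes "norm q < 1" "norm z < 1"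
  shows "(\<Sum>n. qpoch q a n / qpoch q q n * z ^ n) = qpoch_inf q (a * z) / qpoch_inf q z"
proof -
  define F where "F = (\<lambda>z. \<Sum>n. qpoch q a n / qpoch q q n * z ^ n)"
  have iter: "qpoch q z n * F z = qpoch q (a * z) n * F (q ^ n * z)" for n
  proof (induction n)
    case (Suc n)
    have "(1 - q ^ n * z) * F (q ^ n * z) = (1 - a * (q ^ n * z)) * F (q * (q ^ n * z))"
      unfolding F_def by (intro q_binomial_step norm_power_mult_less_1 assms)
    moreover have "qpoch q z (Suc n) * F z
        = qpoch q (a * z) n * ((1 - q ^ n * z) * F (q ^ n * z))"
      using arg_cong[OF Suc, of "\<lambda>w. (1 - q ^ n * z) * w"] by (simp add: qpoch_Suc mult_ac)
    ultimately show ?case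
      by (simp add: qpoch_Suc mult_ac)
  qed simp
  have F0: "F 0 = 1"
    using powser_zero[of "\<lambda>n. qpoch q a n / qpoch q q n"] by (simp add: F_def)
  have "(\<lambda>n. F (q ^ n * z)) \<longlonglongrightarrow> F 0"
  proof (cases "z = 0")
    case False
    have "isCont F 0"
      unfolding F_def
      by (rule isCont_powser[OF summable_norm_cancel[OF summable_norm_q_binomial[OF assms]]])
         (use False in simp)
    moreover have "(\<lambda>n. q ^ n * z) \<longlonglongrightarrow> 0"
      by (intro tendsto_mult_left_zero LIMSEQ_power_zero assms)
    ultimately show ?thesis
      by (rule isCont_tendsto_compose)
  qed simp
  then have "(\<lambda>n. qpoch q (a * z) n * F (q ^ n * z)) \<longlonglongrightarrow> qpoch_inf q (a * z) * 1"
    unfolding F0 by (intro tendsto_mult qpoch_tendsto_qpoch_inf assms)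
  moreover have "(\<lambda>n. qpoch q z n * F z) \<longlonglongrightarrow> qpoch_inf q z * F z"
    by (intro tendsto_mult_right qpoch_tendsto_qpoch_inf assms)
  ultimately have "qpoch_inf q z * F z = qpoch_inf q (a * z)"
    using LIMSEQ_unique unfolding iter by fastforce
  moreover have "qpoch_inf q z \<noteq> 0"
    using assms by (intro qpoch_inf_nonzero qpoch_nonzero)
  ultimately show ?thesis
    by (simp add: F_def field_simps)
qed

section \<open>Interchange of summations\<close>

text \<open>
  Domination by a product of two summable sequences makes the double series absolutely summable
  over \<open>\<nat> \<times> \<nat>\<close>, where unordered summation allows the interchange. The bounds on the inner
  sums serve to identify the unordered sums with the ordinary ones.
\<close>

lemma suminf_swap:
  fixes f :: "nat \<Rightarrow> nat \<Rightarrow> 'a :: banach"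
  assumes A: "summable A" and B: "summable B"
    and le: "\<And>i j. norm (f i j) \<le> A i * B j"
    and nonneg: "\<And>i. 0 \<le> A i" "\<And>j. 0 \<le> B j"
  shows "(\<Sum>i. \<Sum>j. f i j) = (\<Sum>j. \<Sum>i. f i j)"
proof -
  have summ_i: "summable (\<lambda>i. norm (f i j))" for j
    by (rule summable_comparison_test'[OF summable_mult2[OF A]]) (use le in auto)
  have summ_j: "summable (\<lambda>j. norm (f i j))" for i
    by (rule summable_comparison_test'[OF summable_mult[OF B]]) (use le in auto)
  have bound_j: "norm (\<Sum>j. f i j) \<le> A i * (\<Sum>j. B j)" for i
  proof -
    have "norm (\<Sum>j. f i j) \<le> (\<Sum>j. A i * B j)"
      by (intro norm_suminf_le le summable_mult B)
    then show ?thesis using B by (simp add: suminf_mult)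
  qed
  have bound_i: "norm (\<Sum>i. f i j) \<le> (\<Sum>i. A i) * B j" for j
  proof -
    have "norm (\<Sum>i. f i j) \<le> (\<Sum>i. A i * B j)"
      by (intro norm_suminf_le le summable_mult2 A)
    then show ?thesis using A by (simp add: suminf_mult2)
  qed
  have outer_i: "summable (\<lambda>i. norm (\<Sum>j. f i j))"
    by (rule summable_comparison_test'[OF summable_mult2[OF A], of 0]) (use bound_j in simp)
  have outer_j: "summable (\<lambda>j. norm (\<Sum>i. f i j))"
    by (rule summable_comparison_test'[OF summable_mult[OF B], of 0]) (use bound_i in simp)
  have to_infsum: "suminf g = infsum g UNIV" if "summable (\<lambda>n. norm (g n))" for g :: "nat \<Rightarrow> 'a"
    using norm_summable_imp_has_sum[OF that summable_sums[OF summable_norm_cancel[OF that]]]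
    by (simp add: infsumI)
  have abs: "(\<lambda>x. norm (case x of (i, j) \<Rightarrow> f i j)) summable_on UNIV \<times> UNIV"
  proof (rule Infinite_Sum.abs_summable_on_comparison_test')
    have "A summable_on UNIV" "B summable_on UNIV"
      using A B nonneg by (simp_all add: summable_on_UNIV_nonneg_real_iff)
    then show "(\<lambda>(i, j). A i * B j) summable_on UNIV \<times> UNIV"
      using nonneg
      by (intro summable_on_SigmaI[where g = "\<lambda>i. A i * infsum B UNIV"])
         (auto intro!: has_sum_cmult_right summable_on_cmult_left)
  qed (use le in auto)
  have "(\<Sum>i. \<Sum>j. f i j) = (\<Sum>\<^sub>\<infinity>i. \<Sum>\<^sub>\<infinity>j. f i j)"
    using to_infsum[OF outer_i] by (simp only: to_infsum[OF summ_j])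
  also have "\<dots> = (\<Sum>\<^sub>\<infinity>j. \<Sum>\<^sub>\<infinity>i. f i j)"
    by (rule infsum_swap_banach[OF abs_summable_summable[OF abs]])
  also have "\<dots> = (\<Sum>j. \<Sum>i. f i j)"
    using to_infsum[OF outer_j] by (simp only: to_infsum[OF summ_i])
  finally show ?thesis .
qed

lemma norm_mult_power_power_le:
  fixes q w :: complex
  assumes "norm q < 1"
  shows "norm (w * (q ^ i) ^ j) \<le> norm w"
proof -
  have "norm ((q ^ i) ^ j) \<le> 1"
    using assms by (simp add: norm_power power_le_one flip: power_mult)
  then show ?thesis
    using mult_left_mono[of _ 1 "norm w"] by (simp add: norm_mult)
qed

lemma summable_mult_power_power:
  fixes q :: complex and f :: "nat \<Rightarrow> complex"
  assumes "norm q < 1" "summable (\<lambda>j. norm (f j))"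
  shows "summable (\<lambda>j. f j * (q ^ i) ^ j)"
  by (rule summable_comparison_test'[OF assms(2), of 0]) (rule norm_mult_power_power_le[OF assms(1)])

text \<open>
  Since \<open>\<bar>q\<bar> < 1\<close>, the coupling factor \<open>q\<^bsup>(m+n)r\<^esup>\<close> has norm at most \<open>1\<close>, so
  \<open>\<bar>f r\<bar> \<bar>g m\<bar> \<bar>h n\<bar>\<close> dominates the triple series. The sum over \<open>r\<close> is moved outwards in two
  steps, past \<open>m\<close> for fixed \<open>n\<close> and then past \<open>n\<close>.
\<close>

lemma suminf_triple_power:
  fixes q :: complex and f g h :: "nat \<Rightarrow> complex"
  assumes q: "norm q < 1"
    and f: "summable (\<lambda>r. norm (f r))" and g: "summable (\<lambda>m. norm (g m))"
    and h: "summable (\<lambda>n. norm (h n))"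
  shows "(\<Sum>n. \<Sum>m. h n * g m * (\<Sum>r. f r * (q ^ (m + n)) ^ r))
    = (\<Sum>r. f r * (\<Sum>m. g m * (q ^ r) ^ m) * (\<Sum>n. h n * (q ^ r) ^ n))"
proof -
  define G where "G r = (\<Sum>m. g m * (q ^ r) ^ m)" for r
  note le = norm_mult_power_power_le[OF q] and damp = summable_mult_power_power[OF q]
  have G: "norm (G r) \<le> (\<Sum>m. norm (g m))" for r
    unfolding G_def by (intro norm_suminf_le le g)
  have inner: "(\<Sum>m. h n * g m * (\<Sum>r. f r * (q ^ (m + n)) ^ r))
      = (\<Sum>r. f r * G r * (h n * (q ^ r) ^ n))" for n
  proof -
    have "(\<Sum>m. h n * g m * (\<Sum>r. f r * (q ^ (m + n)) ^ r))
        = (\<Sum>m. \<Sum>r. h n * g m * (f r * (q ^ (m + n)) ^ r))"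
      by (intro suminf_cong suminf_mult[symmetric] damp f)
    also have "\<dots> = (\<Sum>r. \<Sum>m. h n * g m * (f r * (q ^ (m + n)) ^ r))"
    proof (rule suminf_swap)
      show "summable (\<lambda>m. norm (h n) * norm (g m))" "summable (\<lambda>r. norm (f r))"
        using f g by (auto intro: summable_mult)
      show "norm (h n * g m * (f r * (q ^ (m + n)) ^ r)) \<le> norm (h n) * norm (g m) * norm (f r)"
        for m r
        using mult_left_mono[OF le[of "f r" "m + n" r], of "norm (h n) * norm (g m)"]
        by (simp add: norm_mult)
    qed auto
    also have "\<dots> = (\<Sum>r. f r * G r * (h n * (q ^ r) ^ n))"
    proof (rule suminf_cong)
      fix r
      have "(\<Sum>m. h n * g m * (f r * (q ^ (m + n)) ^ r))
          = (\<Sum>m. f r * h n * (q ^ r) ^ n * (g m * (q ^ r) ^ m))"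
        by (intro suminf_cong) (simp add: power_add power_mult_distrib mult_ac flip: power_mult)
      also have "\<dots> = f r * h n * (q ^ r) ^ n * G r"
        unfolding G_def by (intro suminf_mult damp g)
      finally show "(\<Sum>m. h n * g m * (f r * (q ^ (m + n)) ^ r)) = f r * G r * (h n * (q ^ r) ^ n)"
        by (simp add: mult_ac)
    qed
    finally show ?thesis .
  qed
  have "(\<Sum>n. \<Sum>m. h n * g m * (\<Sum>r. f r * (q ^ (m + n)) ^ r))
      = (\<Sum>n. \<Sum>r. f r * G r * (h n * (q ^ r) ^ n))"
    unfolding inner ..
  also have "\<dots> = (\<Sum>r. \<Sum>n. f r * G r * (h n * (q ^ r) ^ n))"
  proof (rule suminf_swap)
    show "summable (\<lambda>n. norm (h n))" "summable (\<lambda>r. norm (f r) * (\<Sum>m. norm (g m)))"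
      using f h by (auto intro: summable_mult2)
    show "norm (f r * G r * (h n * (q ^ r) ^ n)) \<le> norm (h n) * (norm (f r) * (\<Sum>m. norm (g m)))"
      for n r
    proof -
      have "norm (f r) * norm (G r) * norm (h n * (q ^ r) ^ n)
          \<le> norm (f r) * (\<Sum>m. norm (g m)) * norm (h n)"
        by (intro mult_mono mult_left_mono G le mult_nonneg_nonneg suminf_nonneg g) auto
      then show ?thesis by (simp add: norm_mult mult_ac)
    qed
  qed (auto intro!: mult_nonneg_nonneg suminf_nonneg g)
  also have "\<dots> = (\<Sum>r. f r * G r * (\<Sum>n. h n * (q ^ r) ^ n))"
    by (intro suminf_cong suminf_mult damp h)
  finally show ?thesis unfolding G_def .
qed

section \<open>Andrews' formula for the q-Appell series\<close>

text \<open>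
  This is Andrews' formula. The nonvanishing of \<open>(bu;q)\<^sub>n\<close> and \<open>(b'v;q)\<^sub>n\<close> enters where
  \<open>(q\<^sup>rbu;q)\<^sub>\<infinity>\<close> is rewritten as \<open>(bu;q)\<^sub>\<infinity>/(bu;q)\<^sub>r\<close>, which produces the lower parameters
  of the \<open>\<^sub>3\<phi>\<^sub>2\<close> series.
\<close>

theorem q_appell_eq_phi32:
  assumes q: "norm q < 1" and a: "a \<noteq> 0" "norm a < 1" and u: "norm u < 1" and v: "norm v < 1"
    and c: "\<And>n. qpoch q c n \<noteq> 0"
    and bu: "\<And>n. qpoch q (b * u) n \<noteq> 0" and bv: "\<And>n. qpoch q (b' * v) n \<noteq> 0"
  shows "(\<Sum>n. \<Sum>m. qpoch q a (m + n) * qpoch q b m * qpoch q b' n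
            / (qpoch q c (m + n) * qpoch q q m * qpoch q q n) * u ^ m * v ^ n)
    = qpochs_inf q [a, b * u, b' * v] / qpochs_inf q [c, u, v]
      * phi32 (c / a) u v (b * u) (b' * v) q a"
proof -
  define K where "K = qpoch_inf q a / qpoch_inf q c"
  define f where "f r = qpoch q (c / a) r / qpoch q q r * a ^ r" for r
  define g where "g m = qpoch q b m / qpoch q q m * u ^ m" for m
  define h where "h n = qpoch q b' n / qpoch q q n * v ^ n" for n
  have f: "summable (\<lambda>r. norm (f r))" and g: "summable (\<lambda>m. norm (g m))"
    and h: "summable (\<lambda>n. norm (h n))"
    unfolding f_def g_def h_def by (intro summable_norm_q_binomial q a u v)+
  \<comment> \<open>The coupling quotient, expanded in powers of \<open>q\<^sup>k\<close>.\<close>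
  have quot: "qpoch q a k / qpoch q c k = K * (\<Sum>r. f r * (q ^ k) ^ r)" for k
  proof -
    have "(\<Sum>r. f r * (q ^ k) ^ r)
        = (\<Sum>r. qpoch q (c / a) r / qpoch q q r * (q ^ k * a) ^ r)"
      by (simp add: f_def power_mult_distrib mult_ac)
    also have "\<dots> = qpoch_inf q (q ^ k * c) / qpoch_inf q (q ^ k * a)"
      by (subst q_binomial[OF q norm_power_mult_less_1[OF q a(2)]]) (use a in \<open>simp add: mult_ac\<close>)
    finally show ?thesis
      unfolding K_def by (subst qpoch_quotient) (simp_all add: q a c)
  qed
  \<comment> \<open>The inner sums over \<open>m\<close> and \<open>n\<close> are \<open>q\<close>-binomial series at \<open>q\<^sup>r u\<close> and \<open>q\<^sup>r v\<close>.\<close>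
  have shifted: "(\<Sum>m. qpoch q e m / qpoch q q m * w ^ m * (q ^ r) ^ m)
      = qpoch_inf q (e * w) / qpoch_inf q w * (qpoch q w r / qpoch q (e * w) r)"
    if "norm w < 1" "\<And>n. qpoch q (e * w) n \<noteq> 0" for e w r
  proof -
    have "(\<Sum>m. qpoch q e m / qpoch q q m * w ^ m * (q ^ r) ^ m)
        = (\<Sum>m. qpoch q e m / qpoch q q m * (q ^ r * w) ^ m)"
      by (simp add: power_mult_distrib mult_ac)
    also have "\<dots> = qpoch_inf q (q ^ r * (e * w)) / qpoch_inf q (q ^ r * w)"
      by (subst q_binomial[OF q norm_power_mult_less_1[OF q that(1)]]) (simp add: mult_ac)
    also have "\<dots> = qpoch_inf q (e * w) / qpoch_inf q w * (qpoch q w r / qpoch q (e * w) r)"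
      using qpoch_inf_split[OF q, of "e * w" r] qpoch_inf_split[OF q, of w r] that(2)[of r]
        qpoch_nonzero[OF q that(1), of r]
      by simp
    finally show ?thesis .
  qed
  define M where "M = qpoch_inf q (b * u) / qpoch_inf q u * (qpoch_inf q (b' * v) / qpoch_inf q v)"
  define ratio where "ratio r = qpoch q u r * qpoch q v r / (qpoch q (b * u) r * qpoch q (b' * v) r)"
    for r
  \<comment> \<open>Boundedness gives the convergence needed to pull the constant out of the sum over \<open>r\<close>.\<close>
  have ratio: "Bseq ratio"
  proof (intro convergent_imp_Bseq convergentI)
    show "ratio \<longlonglongrightarrow> qpoch_inf q u * qpoch_inf q v / (qpoch_inf q (b * u) * qpoch_inf q (b' * v))"
      unfolding ratio_def
      by (intro tendsto_intros qpoch_tendsto_qpoch_inf q)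
         (simp add: qpoch_inf_nonzero[OF q bu] qpoch_inf_nonzero[OF q bv])
  qed
  have "(\<Sum>n. \<Sum>m. qpoch q a (m + n) * qpoch q b m * qpoch q b' n
            / (qpoch q c (m + n) * qpoch q q m * qpoch q q n) * u ^ m * v ^ n)
      = (\<Sum>n. \<Sum>m. (K * h n) * g m * (\<Sum>r. f r * (q ^ (m + n)) ^ r))"
  proof (intro suminf_cong)
    fix n m
    have "qpoch q a (m + n) * qpoch q b m * qpoch q b' n
          / (qpoch q c (m + n) * qpoch q q m * qpoch q q n) * u ^ m * v ^ n
        = qpoch q a (m + n) / qpoch q c (m + n) * (h n * g m)"
      by (simp add: g_def h_def mult_ac)
    then show "qpoch q a (m + n) * qpoch q b m * qpoch q b' n
          / (qpoch q c (m + n) * qpoch q q m * qpoch q q n) * u ^ m * v ^ n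
        = (K * h n) * g m * (\<Sum>r. f r * (q ^ (m + n)) ^ r)"
      unfolding quot by (simp add: mult_ac)
  qed
  also have "\<dots> = (\<Sum>r. f r * (\<Sum>m. g m * (q ^ r) ^ m) * (\<Sum>n. K * h n * (q ^ r) ^ n))"
    using h by (intro suminf_triple_power q f g) (simp add: norm_mult summable_mult)
  also have "\<dots> = (\<Sum>r. K * M * (ratio r * f r))"
  proof (intro suminf_cong)
    fix r
    have "(\<Sum>m. g m * (q ^ r) ^ m)
        = qpoch_inf q (b * u) / qpoch_inf q u * (qpoch q u r / qpoch q (b * u) r)"
      unfolding g_def using u bu by (rule shifted)
    moreover have "(\<Sum>n. h n * (q ^ r) ^ n)
        = qpoch_inf q (b' * v) / qpoch_inf q v * (qpoch q v r / qpoch q (b' * v) r)"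
      unfolding h_def using v bv by (rule shifted)
    moreover have "(\<Sum>n. K * h n * (q ^ r) ^ n) = K * (\<Sum>n. h n * (q ^ r) ^ n)"
      unfolding mult.assoc by (intro suminf_mult summable_mult_power_power q h)
    ultimately show "f r * (\<Sum>m. g m * (q ^ r) ^ m) * (\<Sum>n. K * h n * (q ^ r) ^ n)
        = K * M * (ratio r * f r)"
      by (simp add: M_def ratio_def mult_ac)
  qed
  also have "\<dots> = K * M * (\<Sum>r. ratio r * f r)"
    by (intro suminf_mult summable_norm_cancel[OF summable_norm_Bseq_mult] ratio f)
  also have "(\<Sum>r. ratio r * f r) = phi32 (c / a) u v (b * u) (b' * v) q a"
    unfolding phi32_def by (intro suminf_cong) (simp add: ratio_def f_def qpochs_def mult_ac)
  also have "K * M = qpochs_inf q [a, b * u, b' * v] / qpochs_inf q [c, u, v]"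
    by (simp add: K_def M_def qpochs_inf_def)
  finally show ?thesis .
qed

section \<open>The gauge-transformed solution and the Appell series\<close>

theorem proposition3p1:
  fixes q lq h1 h2 l1 l2 k1 k2 t1 t2 lam lamt mu \<alpha>1 \<alpha>2 \<beta>1 \<beta>2 :: complex
    and S :: "complex set" and L :: "complex \<Rightarrow> complex"
  assumes "0 < norm q" and "norm q < 1" and "exp lq = q"
    and "log_branch S L"
    and "t1 \<noteq> 0" and "t2 \<noteq> 0"
    and "lam = (h1 + h2 - l1 - l2 - k1 + k2 + 1) / 2"
    and "mu = - k1 + k2"
    and "lam = lamt + k2"
    and "\<alpha>1 = lpow lq (- l1 + 1/2) / t1"
    and "\<alpha>2 = lpow lq (- l2 + 3/2) / t2"
    and "\<beta>1 = lpow lq (lam - h1 + 1/2) / t1"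
    and "\<beta>2 = lpow lq (lam - h2 + 1/2) / t2"
    and "norm (lpow lq lam * (\<alpha>1 * \<alpha>2 / (\<beta>1 * \<beta>2))) < 1"
    and "qpoch_inf q (lpow lq (- lam + 1)) \<noteq> 0"
    and "\<And>n. qpoch q (lpow lq (k1 - k2 + 1)) n \<noteq> 0"
  shows "\<exists>C. \<forall>x\<in>S.
    norm (q / (\<alpha>1 * x)) < 1 \<longrightarrow> norm (q\<^sup>2 / (\<alpha>2 * x)) < 1 \<longrightarrow>
    (\<forall>n. qpochs q [q\<^sup>2 / (\<beta>1 * x), q\<^sup>2 / (\<beta>2 * x)] n \<noteq> 0) \<longrightarrow>
    lpow (L x) (- k2) * y_x q lq L lam mu \<alpha>1 \<alpha>2 \<beta>1 \<beta>2 x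
      = C * g_appell q lq L lamt h1 h2 l1 l2 k1 k2 t1 t2 x"
proof -
  define a where "a = lpow lq (lamt + k1)"
  define b where "b = lpow lq (lamt + k1 - h2 + l2)"
  define b' where "b' = lpow lq (lamt + k1 - h1 + l1)"
  define c where "c = lpow lq (k1 - k2 + 1)"
  define C where "C = (1 - q) * lpow lq (lam - mu) * qpoch_inf q q * qpoch_inf q c
    / (qpoch_inf q (c / a) * qpoch_inf q a)"
  have lpow_add: "lpow l s * lpow l s' = lpow l (s + s')" for l s s'
    by (simp add: lpow_def exp_add distrib_right)
  have lpow_divide: "lpow l s / lpow l s' = lpow l (s - s')" for l s s'
    by (simp add: lpow_def exp_diff left_diff_distrib)
  have lpow_nonzero: "lpow l s \<noteq> 0" for l s
    by (simp add: lpow_def)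
  have q_lpow: "q = lpow lq 1" "q\<^sup>2 = lpow lq 2"
    using assms(3) by (simp_all add: lpow_def exp_double)
  have lam2: "h1 + h2 = 2 * lam + l1 + l2 + k1 - k2 - 1"
    using assms(7) by (simp add: field_simps)
  have h1: "h1 = 2 * lamt + k2 + l1 + l2 + k1 - 1 - h2"
    using lam2 assms(9) by (simp add: algebra_simps)
  \<comment> \<open>The argument of the \<open>\<^sub>3\<phi>\<^sub>2\<close> series is the first Appell parameter.\<close>
  have z: "lpow lq lam * (\<alpha>1 * \<alpha>2 / (\<beta>1 * \<beta>2)) = a"
  proof -
    have "\<alpha>1 * \<alpha>2 / (\<beta>1 * \<beta>2)
        = lpow lq (- l1 + 1/2) * lpow lq (- l2 + 3/2)
          / (lpow lq (lam - h1 + 1/2) * lpow lq (lam - h2 + 1/2))"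
      using assms(5,6) by (simp add: assms(10-13) field_simps lpow_nonzero)
    also have "\<dots> = lpow lq (- l1 - l2 + 2 - (2 * lam - (h1 + h2) + 1))"
      by (simp add: lpow_add lpow_divide algebra_simps)
    finally show ?thesis
      unfolding lam2 a_def by (simp add: lpow_add assms(9) algebra_simps)
  qed
  have ca: "lpow lq (- lam + 1) = c / a"
    by (simp add: c_def a_def lpow_divide assms(9) algebra_simps)
  show ?thesis
  proof (intro exI[of _ C] ballI impI)
    fix x
    define u where "u = q / (\<alpha>1 * x)"
    define v where "v = q\<^sup>2 / (\<alpha>2 * x)"
    assume "x \<in> S" and "norm (q / (\<alpha>1 * x)) < 1" and "norm (q\<^sup>2 / (\<alpha>2 * x)) < 1"
      and den: "\<forall>n. qpochs q [q\<^sup>2 / (\<beta>1 * x), q\<^sup>2 / (\<beta>2 * x)] n \<noteq> 0"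
    then have u: "norm u < 1" and v: "norm v < 1"
      by (simp_all add: u_def v_def)
    have power_quotient: "lpow lq s / (lpow lq s' / t * x) = lpow lq (s - s') * t * inverse x"
      for s s' t
      by (simp add: divide_inverse mult_ac flip: lpow_divide)
    have u_eq: "u = lpow lq (l1 + 1/2) * t1 * inverse x"
      unfolding u_def assms(10) by (subst q_lpow(1), subst power_quotient) (simp add: add.commute)
    have v_eq: "v = lpow lq (l2 + 1/2) * t2 * inverse x"
      unfolding v_def assms(11) by (subst q_lpow(2), subst power_quotient) (simp add: add.commute)
    \<comment> \<open>Comparing exponents: the lower parameters of the \<open>\<^sub>3\<phi>\<^sub>2\<close> series are \<open>b u\<close> and \<open>b' v\<close>.\<close>
    have "2 - (lam - h1 + 1/2) = (lamt + k1 - h2 + l2) + (l1 + 1/2)"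
      unfolding h1 assms(9) by (simp add: field_simps)
    then have bu: "q\<^sup>2 / (\<beta>1 * x) = b * u"
      unfolding u_eq b_def assms(12) by (subst q_lpow(2), subst power_quotient) (simp add: lpow_add)
    have "2 - (lam - h2 + 1/2) = (lamt + k1 - h1 + l1) + (l2 + 1/2)"
      unfolding h1 assms(9) by (simp add: field_simps)
    then have bv: "q\<^sup>2 / (\<beta>2 * x) = b' * v"
      unfolding v_eq b'_def assms(13) by (subst q_lpow(2), subst power_quotient) (simp add: lpow_add)
    have a1: "norm a < 1"
      using assms(14) unfolding z .
    have andrews: "(\<Sum>n. \<Sum>m. qpoch q a (m + n) * qpoch q b m * qpoch q b' n
            / (qpoch q c (m + n) * qpoch q q m * qpoch q q n) * u ^ m * v ^ n)
        = qpochs_inf q [a, b * u, b' * v] / qpochs_inf q [c, u, v]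
          * phi32 (c / a) u v (b * u) (b' * v) q a"
      using den assms(16) a1 u v
      by (intro q_appell_eq_phi32 assms(2)) (auto simp: bu bv qpochs_def c_def a_def lpow_nonzero)
    have nz: "qpoch_inf q a \<noteq> 0" "qpoch_inf q c \<noteq> 0"
      using a1 assms(2,16) by (simp_all add: c_def qpoch_inf_nonzero qpoch_nonzero)
    have "lpow (L x) (- k1) = lpow (L x) (- k2) * lpow (L x) mu"
      by (simp add: lpow_add assms(8))
    then have "lpow (L x) (- k2) * y_x q lq L lam mu \<alpha>1 \<alpha>2 \<beta>1 \<beta>2 x
      = lpow (L x) (- k1) * ((1 - q) * lpow lq (lam - mu)
          * (qpochs_inf q [b * u, b' * v, q] / qpochs_inf q [u, v, c / a])
          * phi32 (c / a) u v (b * u) (b' * v) q a)"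
      unfolding y_x_def z ca bu bv u_def[symmetric] v_def[symmetric]
      by (simp only: mult_ac)
    also have "\<dots> = C * (lpow (L x) (- k1) * (qpochs_inf q [a, b * u, b' * v] / qpochs_inf q [c, u, v]
          * phi32 (c / a) u v (b * u) (b' * v) q a))"
      using nz by (simp add: C_def qpochs_inf_def mult_ac)
    also have "\<dots> = C * g_appell q lq L lamt h1 h2 l1 l2 k1 k2 t1 t2 x"
      unfolding g_appell_def andrews[symmetric] u_eq[symmetric] v_eq[symmetric]
      unfolding a_def b_def b'_def c_def ..
    finally show "lpow (L x) (- k2) * y_x q lq L lam mu \<alpha>1 \<alpha>2 \<beta>1 \<beta>2 x
      = C * g_appell q lq L lamt h1 h2 l1 l2 k1 k2 t1 t2 x" .
  qed
qed

end
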